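(* Let $X_1,X_2,\ldots$ be i.i.d.-$P_0$ for some $P_0\in\mathscr{P}$, where $\mathscr{P}$ is a dominated model with prior $\Pi$, and let a (measurable) subset $V\subset\mathscr{P}$ be given. Assume that $P_0^n\ll P_n^\Pi$ for all $n\geq1$ and that there exist constants $K,L>0$ and a sequence of (measurable) submodels $(\mathscr{P}_n)$, $\mathscr{P}_n\subset\mathscr{P}$, such that for large enough $n\geq1$: (i) there is a cover $V_1,\ldots,V_{N_n}$ of $V\cap\mathscr{P}_n$ of order $N_n\leq\exp(\tfrac12Ln)$ with tests $\phi_{1,n},\ldots,\phi_{N_n,n}$ such that \[ P_0^n\phi_{i,n}+\sup_{P\in V_i}P_0^n\frac{dP^n}{dP_n^\Pi}(1-\phi_{i,n})\leq e^{-nL}\qquad\text{for all }1\leq i\leq N_n; \] (ii) the prior mass satisfies $\Pi(\mathscr{P}\setminus\mathscr{P}_n)\leq\exp(-nK)$ and \[ \sup_{P\in V\setminus\mathscr{P}_n}\ \sup_{Q\in B}P_0\Bigl(\frac{dP}{dQ}\Bigr)\leq e^{K/2} \] for some model subset $B$ (not depending on $n$) such that $\Pi(B)>0$. Then $\Pi(V\mid X_1,\ldots,X_n)\to0$, $P_0$-almost surely.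
   Context: Setting. $(\mathscr{X},\mathscr{A})$ is a measurable space (the sample space). The model $\mathscr{P}$ is a collection of probability measures on $(\mathscr{X},\mathscr{A})$ dominated by a $\sigma$-finite measure $\mu$, with densities $p=dP/d\mu$; it carries a $\sigma$-algebra $\mathscr{B}$ such that $P\mapsto P(A)$ is measurable for every $A\in\mathscr{A}$ (densities are taken measurable in $(x,P)$, and model subsets to which $\Pi$ is applied, including the covering sets, are measurable). The prior $\Pi$ is a probability measure on $(\mathscr{P},\mathscr{B})$. Notation: $P_0f=\int f\,dP_0$. The prior predictive distributions are $P_n^\Pi(A)=\int P^n(A)\,d\Pi(P)$, $A\in\sigma(X_1,\ldots,X_n)$, and $dP^n/dP_n^\Pi$ denotes the ratio of $\mu^n$-densities. A test $\phi_{i,n}$ is a measurable function $\mathscr{X}^n\to[0,1]$. The posterior is \[ \Pi(A\mid X_1,\ldots,X_n)=\int_A\prod_{i=1}^n p(X_i)\,d\Pi(P)\Bigm/\int_{\mathscr{P}}\prod_{i=1}^n p(X_i)\,d\Pi(P). \] "$P_0$-almost surely" refers to $P_0^\infty$. Conventions: $P_0(dP/dQ)=\int_{\{p_0>0,\,p>0\}}(p/q)\,dP_0$, and its finiteness includes that $q>0$ $P_0$-almost everywhere on $\{p>0\}$. *)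

theory Defs
  imports "HOL-Probability.Probability"
begin

text \<open>
  The model is \<open>space Prior\<close>, its \<open>\<sigma>\<close>-algebra is \<open>sets Prior\<close>, and \<open>p P\<close> is the density
  \<open>dP/d\<mu>\<close>. Domination of the model is part of \<open>model_density\<close>, which also forces
  \<open>sets P = sets \<mu>\<close>.
\<close>

locale dominated_model = sigma_finite_measure \<mu> + prior: prob_space Prior
  for \<mu> :: "'a measure" and Prior :: "'a measure measure" +
  fixes p :: "'a measure \<Rightarrow> 'a \<Rightarrow> real"
  assumes model_prob_space: "P \<in> space Prior \<Longrightarrow> prob_space P"
    and model_eval_measurable:
      "A \<in> sets \<mu> \<Longrightarrow> (\<lambda>P. emeasure P A) \<in> borel_measurable Prior"
    and density_measurable: "(\<lambda>(x, P). p P x) \<in> borel_measurable (\<mu> \<Otimes>\<^sub>M Prior)"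
    and density_nonneg: "P \<in> space Prior \<Longrightarrow> x \<in> space \<mu> \<Longrightarrow> 0 \<le> p P x"
    and model_density: "P \<in> space Prior \<Longrightarrow> P = density \<mu> (\<lambda>x. ennreal (p P x))"

text \<open>
  Samples of size \<open>n\<close> are indexed by \<open>{..<n}\<close>, so that \<open>X\<^sub>1, \<dots>, X\<^sub>n\<close> are
  \<open>x 0, \<dots>, x (n - 1)\<close>.
\<close>

abbreviation pow_measure :: "'a measure \<Rightarrow> nat \<Rightarrow> (nat \<Rightarrow> 'a) measure" where
  "pow_measure P n \<equiv> Pi\<^sub>M {..<n} (\<lambda>_. P)"

definition likelihood ::
  "('a measure \<Rightarrow> 'a \<Rightarrow> real) \<Rightarrow> nat \<Rightarrow> 'a measure \<Rightarrow> (nat \<Rightarrow> 'a) \<Rightarrow> ennreal" where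
  "likelihood p n P x = (\<Prod>i<n. ennreal (p P (x i)))"

definition posterior ::
  "'a measure measure \<Rightarrow> ('a measure \<Rightarrow> 'a \<Rightarrow> real) \<Rightarrow> nat \<Rightarrow> 'a measure set \<Rightarrow>
    (nat \<Rightarrow> 'a) \<Rightarrow> ennreal" where
  "posterior Prior p n A x =
    (\<integral>\<^sup>+P\<in>A. likelihood p n P x \<partial>Prior) / (\<integral>\<^sup>+P. likelihood p n P x \<partial>Prior)"

definition prior_predictive ::
  "'a measure \<Rightarrow> 'a measure measure \<Rightarrow> nat \<Rightarrow> (nat \<Rightarrow> 'a) measure" where
  "prior_predictive \<mu> Prior n =
    measure_of (space (pow_measure \<mu> n)) (sets (pow_measure \<mu> n))
      (\<lambda>A. \<integral>\<^sup>+P. emeasure (pow_measure P n) A \<partial>Prior)"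

text \<open>
  The ratio of the \<open>\<mu>\<^sup>n\<close>-densities of \<open>P\<^sup>n\<close> and of the prior predictive distribution;
  see \<open>pow_measure_eq_density\<close> and \<open>prior_predictive_eq_density\<close> below.
\<close>

definition predictive_ratio ::
  "'a measure measure \<Rightarrow> ('a measure \<Rightarrow> 'a \<Rightarrow> real) \<Rightarrow> nat \<Rightarrow> 'a measure \<Rightarrow>
    (nat \<Rightarrow> 'a) \<Rightarrow> ennreal" where
  "predictive_ratio Prior p n P x =
    likelihood p n P x / (\<integral>\<^sup>+Q. likelihood p n Q x \<partial>Prior)"

definition is_test :: "'a measure \<Rightarrow> nat \<Rightarrow> ((nat \<Rightarrow> 'a) \<Rightarrow> real) \<Rightarrow> bool" where
  "is_test \<mu> n \<phi> \<longleftrightarrow> \<phi> \<in> borel_measurable (pow_measure \<mu> n) \<and>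
    (\<forall>x\<in>space (pow_measure \<mu> n). 0 \<le> \<phi> x \<and> \<phi> x \<le> 1)"

text \<open>
  \<open>P\<^sub>0(dP/dQ)\<close>. Division in \<^typ>\<open>ennreal\<close> gives \<open>a / 0 = \<infinity>\<close> for \<open>a > 0\<close>, so the integral
  is infinite unless \<open>p Q > 0\<close> holds \<open>P\<^sub>0\<close>-almost everywhere on \<open>{p P > 0}\<close>.
\<close>

definition ratio_expectation ::
  "('a measure \<Rightarrow> 'a \<Rightarrow> real) \<Rightarrow> 'a measure \<Rightarrow> 'a measure \<Rightarrow> 'a measure \<Rightarrow> ennreal" where
  "ratio_expectation p P0 P Q =
    (\<integral>\<^sup>+x\<in>{x. p P0 x > 0 \<and> p P x > 0}. ennreal (p P x) / ennreal (p Q x) \<partial>P0)"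

context dominated_model
begin

lemma likelihood_measurable:
  "(\<lambda>(x, P). likelihood p n P x) \<in> borel_measurable (pow_measure \<mu> n \<Otimes>\<^sub>M Prior)"
proof -
  have "(\<lambda>z. p (snd z) (fst z i)) \<in> borel_measurable (pow_measure \<mu> n \<Otimes>\<^sub>M Prior)" if "i < n" for i
  proof -
    have "(\<lambda>z. (fst z i, snd z)) \<in> pow_measure \<mu> n \<Otimes>\<^sub>M Prior \<rightarrow>\<^sub>M \<mu> \<Otimes>\<^sub>M Prior"
      using that by (intro measurable_Pair measurable_compose[OF measurable_fst] measurable_snd)
        (auto intro!: measurable_component_singleton)
    from measurable_compose[OF this density_measurable] show ?thesis by simp
  qed
  then show ?thesis
    unfolding likelihood_def case_prod_beta by (intro borel_measurable_prod_ennreal) auto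
qed

lemma pow_measure_eq_density:
  assumes P: "P \<in> space Prior"
  shows "pow_measure P n = density (pow_measure \<mu> n) (likelihood p n P)"
proof -
  interpret Pr: prob_space P using P by (rule model_prob_space)
  interpret PP: product_sigma_finite "\<lambda>_::nat. P"
    by standard
  interpret MM: product_sigma_finite "\<lambda>_::nat. \<mu>"
    by standard
  have D: "P = density \<mu> (\<lambda>x. ennreal (p P x))" using P by (rule model_density)
  have S: "sets P = sets \<mu>" by (subst D) simp
  have m1: "(\<lambda>x. p P x) \<in> borel_measurable \<mu>"
    using measurable_compose[OF measurable_Pair2'[OF P] density_measurable] by simp
  have m: "likelihood p n P \<in> borel_measurable (pow_measure \<mu> n)"
    using measurable_compose[OF measurable_Pair2'[OF P] likelihood_measurable[of n]] by simp
  show ?thesis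
  proof (rule PP.PiM_eqI[symmetric])
    show "sets (density (pow_measure \<mu> n) (likelihood p n P)) = sets (pow_measure P n)"
      using S by (simp cong: sets_PiM_cong)
    fix A :: "nat \<Rightarrow> 'a set" assume A: "\<And>i. i \<in> {..<n} \<Longrightarrow> A i \<in> sets P"
    then have A': "\<And>i. i \<in> {..<n} \<Longrightarrow> A i \<in> sets \<mu>" using S by simp
    have eqP: "emeasure P (A i) = (\<integral>\<^sup>+x. ennreal (p P x) * indicator (A i) x \<partial>\<mu>)" if "i < n" for i
      using A'[of i] that m1 by (subst D) (simp add: emeasure_density)
    have "emeasure (density (pow_measure \<mu> n) (likelihood p n P)) (Pi\<^sub>E {..<n} A)
      = (\<integral>\<^sup>+x. likelihood p n P x * indicator (Pi\<^sub>E {..<n} A) x \<partial>pow_measure \<mu> n)"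
      using m A' by (intro emeasure_density sets_PiM_I_finite) auto
    also have "\<dots> = (\<integral>\<^sup>+x. (\<Prod>i<n. ennreal (p P (x i)) * indicator (A i) (x i)) \<partial>pow_measure \<mu> n)"
    proof (rule nn_integral_cong)
      fix x assume x: "x \<in> space (pow_measure \<mu> n)"
      have "(indicator (Pi\<^sub>E {..<n} A) x :: ennreal) = (\<Prod>i<n. indicator (A i) (x i))"
      proof (cases "x \<in> Pi\<^sub>E {..<n} A")
        case True then show ?thesis by (auto simp: PiE_mem)
      next
        case False
        then obtain i where "i < n" "x i \<notin> A i"
          using x by (auto simp: space_PiM PiE_iff)
        then have "(\<Prod>i<n. indicator (A i) (x i) :: ennreal) = 0"
            by (intro prod_zero bexI[of _ i]) auto
        then show ?thesis using False by simp
      qed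
      then show "likelihood p n P x * indicator (Pi\<^sub>E {..<n} A) x =
          (\<Prod>i<n. ennreal (p P (x i)) * indicator (A i) (x i))"
        by (simp add: likelihood_def prod.distrib)
    qed
    also have "\<dots> = (\<Prod>i<n. \<integral>\<^sup>+x. ennreal (p P x) * indicator (A i) x \<partial>\<mu>)"
      using A' m1 by (intro MM.product_nn_integral_prod) auto
    finally show "emeasure (density (pow_measure \<mu> n) (likelihood p n P)) (Pi\<^sub>E {..<n} A) =
        (\<Prod>i<n. emeasure P (A i))"
      using eqP by simp
  qed simp
qed

lemma
  shows prior_predictive_eq_density:
      "prior_predictive \<mu> Prior n =
        density (pow_measure \<mu> n) (\<lambda>x. \<integral>\<^sup>+P. likelihood p n P x \<partial>Prior)"
    and emeasure_prior_predictive: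
      "A \<in> sets (pow_measure \<mu> n) \<Longrightarrow>
        emeasure (prior_predictive \<mu> Prior n) A = (\<integral>\<^sup>+P. emeasure (pow_measure P n) A \<partial>Prior)"
proof -
  interpret MM: product_sigma_finite "\<lambda>_::nat. \<mu>"
    by standard
  interpret Mn: sigma_finite_measure "pow_measure \<mu> n"
    by (rule MM.sigma_finite) simp
  interpret PS: pair_sigma_finite "pow_measure \<mu> n" Prior ..
  let ?f = "\<lambda>x. \<integral>\<^sup>+P. likelihood p n P x \<partial>Prior"
  have mf: "?f \<in> borel_measurable (pow_measure \<mu> n)"
    using likelihood_measurable[of n] by (rule prior.borel_measurable_nn_integral)
  have *: "(\<integral>\<^sup>+P. emeasure (pow_measure P n) A \<partial>Prior) = emeasure (density (pow_measure \<mu> n) ?f) A"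
    if A: "A \<in> sets (pow_measure \<mu> n)" for A
  proof -
    have mz: "(\<lambda>(x, P). likelihood p n P x * indicator A x) \<in> borel_measurable (pow_measure \<mu> n \<Otimes>\<^sub>M Prior)"
      using likelihood_measurable[of n] A unfolding case_prod_beta by measurable
    have mP: "likelihood p n P \<in> borel_measurable (pow_measure \<mu> n)" if "P \<in> space Prior" for P
      using measurable_compose[OF measurable_Pair2'[OF that] likelihood_measurable[of n]] by simp
    have mx: "(\<lambda>P. likelihood p n P x) \<in> borel_measurable Prior" if "x \<in> space (pow_measure \<mu> n)" for x
      using measurable_compose[OF measurable_Pair1'[OF that] likelihood_measurable[of n]] by simp
    have "(\<integral>\<^sup>+P. emeasure (pow_measure P n) A \<partial>Prior) =
        (\<integral>\<^sup>+P. (\<integral>\<^sup>+x. likelihood p n P x * indicator A x \<partial>pow_measure \<mu> n) \<partial>Prior)"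
      using A mP by (intro nn_integral_cong) (simp add: pow_measure_eq_density emeasure_density)
    also have "\<dots> = (\<integral>\<^sup>+x. (\<integral>\<^sup>+P. likelihood p n P x * indicator A x \<partial>Prior) \<partial>pow_measure \<mu> n)"
      using PS.Fubini'[OF mz] by simp
    also have "\<dots> = (\<integral>\<^sup>+x. ?f x * indicator A x \<partial>pow_measure \<mu> n)"
      using mx by (intro nn_integral_cong) (simp add: nn_integral_multc)
    finally show ?thesis using mf A by (simp add: emeasure_density)
  qed
  have "prior_predictive \<mu> Prior n =
      measure_of (space (density (pow_measure \<mu> n) ?f)) (sets (density (pow_measure \<mu> n) ?f))
        (emeasure (density (pow_measure \<mu> n) ?f))"
    unfolding prior_predictive_def space_density sets_density
    by (rule measure_of_eq) (use * in \<open>auto simp: sets.space_closed sets.sigma_sets_eq\<close>)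
  also have "\<dots> = density (pow_measure \<mu> n) ?f" by (rule measure_of_of_measure)
  finally show "prior_predictive \<mu> Prior n = density (pow_measure \<mu> n) ?f" .
  then show "emeasure (prior_predictive \<mu> Prior n) A = (\<integral>\<^sup>+P. emeasure (pow_measure P n) A \<partial>Prior)"
    if "A \<in> sets (pow_measure \<mu> n)" for A
    using *[OF that] by simp
qed

end

end

theory Submission
  imports Defs
begin

text \<open>
  It suffices that the expected posterior masses of \<open>V\<close> under \<open>P\<^sub>0\<^sup>n\<close> are eventually bounded by the
  terms of a convergent series, since the random series of posterior masses then converges almost
  surely. By Fubini, the expected posterior mass of a set is the prior integral over that set of
  \<open>P\<^sub>0\<^sup>n (dP\<^sup>n/dP\<^sub>n\<^sup>\<Pi>)\<close>. On \<open>V \<inter> \<P>\<^sub>n\<close> one splits with the tests and sums over the cover,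
  which costs a factor \<open>exp (nL/2)\<close> against \<open>exp (-nL)\<close>. On \<open>V - \<P>\<^sub>n\<close> the prior predictive
  density is bounded below by its part coming from \<open>B\<close>, and Jensen's inequality for the reciprocal
  together with independence gives \<open>P\<^sub>0\<^sup>n (dP\<^sup>n/dP\<^sub>n\<^sup>\<Pi>) \<le> exp (nK/2) / \<Pi>(B)\<close>, against the prior
  mass \<open>exp (-nK)\<close>.
\<close>

section \<open>Jensen's inequality for the reciprocal in \<open>ennreal\<close>\<close>

text \<open>The reciprocal is convex, and its tangent at \<open>1 / s\<close> is
  \<open>2 * s - s\<^sup>2 * q\<close>. The linear term stands on the right so that no truncated
  subtraction of \<open>ennreal\<close> occurs and \<open>q\<close> may be \<open>0\<close> or
  infinite.\<close>

lemma two_times_le_inverse_plus_tangent: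
  fixes q :: ennreal and s :: real
  assumes "0 \<le> s"
  shows "2 * ennreal s \<le> inverse q + q * ennreal (s\<^sup>2)"
proof (cases q)
  case (real r)
  show ?thesis
  proof (cases "r = 0")
    case False
    with real have "r > 0" by simp
    \<comment> \<open>For finite positive \<open>r\<close>, the gap between the two sides is exactly
      this square over \<open>r\<close>.\<close>
    have "0 \<le> (s * r - 1)\<^sup>2 / r" using \<open>r > 0\<close> by simp
    also have "\<dots> = inverse r + r * s\<^sup>2 - 2 * s"
      using \<open>r > 0\<close> by (simp add: field_simps power2_eq_square)
    finally have "ennreal (2 * s) \<le> ennreal (inverse r + r * s\<^sup>2)"
      by (intro ennreal_leI) simp
    then show ?thesis
      using real \<open>r > 0\<close> assms
      by (simp add: ennreal_mult ennreal_plus inverse_ennreal)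
  qed (use real in simp)
next
  case top
  then show ?thesis using assms by (cases "s = 0") (auto simp: ennreal_top_mult)
qed

text \<open>Jensen's inequality for the reciprocal, by integrating its tangent at the mean of \<open>f\<close>.\<close>

lemma (in finite_measure) square_measure_over_nn_integral_le:
  assumes f: "f \<in> borel_measurable M"
  shows "(emeasure M (space M))\<^sup>2 / (\<integral>\<^sup>+x. f x \<partial>M) \<le> (\<integral>\<^sup>+x. inverse (f x) \<partial>M)"
proof -
  define b where "b = measure M (space M)"
  have b: "emeasure M (space M) = ennreal b" "b \<ge> 0"
    by (auto simp: b_def emeasure_eq_measure)
  show ?thesis
  proof (cases "\<integral>\<^sup>+x. f x \<partial>M")
    case (real m)
    show ?thesis
    proof (cases "m = 0")
      case True
      \<comment> \<open>A zero integral makes the reciprocal infinite almost everywhere, so both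
        sides are infinite, unless \<open>M\<close> is the null measure and both are
        \<open>0\<close>.\<close>
      have "AE x in M. f x = 0"
        using real True f by (simp add: nn_integral_0_iff_AE)
      then have "AE x in M. inverse (f x) = \<top>" by eventually_elim simp
      then have "(\<integral>\<^sup>+x. inverse (f x) \<partial>M) = (\<integral>\<^sup>+x. \<top> \<partial>M)" by (rule nn_integral_cong_AE)
      then show ?thesis using real True b by (cases "b = 0") (auto simp: ennreal_top_mult)
    next
      case False
      with real have m: "m > 0" by simp
      \<comment> \<open>The tangent for this \<open>s\<close> touches at
        \<open>1 / s = m / b\<close>, the mean of \<open>f\<close> under the normalised measure;
        this choice makes the bound sharp.\<close>
      define s where "s = b / m"
      have s: "s \<ge> 0" using b m by (simp add: s_def)
      have "ennreal (2 * s * b) = (\<integral>\<^sup>+x. 2 * ennreal s \<partial>M)"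
        using b s by (simp add: ennreal_mult)
      also have "\<dots> \<le> (\<integral>\<^sup>+x. inverse (f x) + f x * ennreal (s\<^sup>2) \<partial>M)"
        by (intro nn_integral_mono two_times_le_inverse_plus_tangent s)
      also have "\<dots> = (\<integral>\<^sup>+x. inverse (f x) \<partial>M) + ennreal (m * s\<^sup>2)"
        using f real m by (simp add: nn_integral_add nn_integral_multc ennreal_mult)
      finally have *: "ennreal (2 * s * b) \<le> (\<integral>\<^sup>+x. inverse (f x) \<partial>M) + ennreal (m * s\<^sup>2)" .
      have sq: "m * s\<^sup>2 = b\<^sup>2 / m" "2 * s * b = b\<^sup>2 / m + b\<^sup>2 / m"
        using m by (auto simp: s_def power2_eq_square)
      \<comment> \<open>With \<open>t = b\<^sup>2 / m\<close>, the previous estimate says that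
        \<open>t + t\<close> is at most the integral plus \<open>t\<close>. As \<open>t\<close> is
        finite, one copy cancels.\<close>
      have "ennreal (b\<^sup>2 / m) \<le> (\<integral>\<^sup>+x. inverse (f x) \<partial>M)"
        using * m unfolding sq
        by (subst (asm) ennreal_plus)
          (auto simp: add.commute[of "\<integral>\<^sup>+x. inverse (f x) \<partial>M"] ennreal_add_left_cancel_le)
      then show ?thesis
        using real m b by (simp add: divide_ennreal ennreal_power)
    qed
  qed simp
qed

section \<open>Almost sure convergence from summable expectations\<close>

lemma suminf_ennreal_finite_imp_LIMSEQ_0:
  fixes f :: "nat \<Rightarrow> ennreal"
  assumes "(\<Sum>n. f n) \<noteq> \<top>"
  shows "f \<longlonglongrightarrow> 0"
proof -
  have fin: "f n \<noteq> \<top>" for n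
    using assms ennreal_suminf_lessD[of f \<top> n] by (simp add: top.not_eq_extremum)
  then have eq: "f n = ennreal (enn2real (f n))" for n by (simp add: less_top)
  have "summable (\<lambda>n. enn2real (f n))"
    by (rule summable_suminf_not_top) (use assms fin in \<open>auto simp flip: eq\<close>)
  then have "(\<lambda>n. enn2real (f n)) \<longlonglongrightarrow> 0" by (rule summable_LIMSEQ_zero)
  then have "(\<lambda>n. ennreal (enn2real (f n))) \<longlonglongrightarrow> ennreal 0" by (rule tendsto_ennrealI)
  then show ?thesis using eq by simp
qed

text \<open>The sum of the tail from \<open>n0\<close> on has finite expectation by monotone
  convergence. It is therefore finite almost surely, which forces its terms to tend to
  \<open>0\<close>; neither Markov's inequality nor Borel-Cantelli is called for.\<close>

lemma AE_LIMSEQ_0_if_summable_nn_integral: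
  assumes f: "\<And>n. f n \<in> borel_measurable M"
    and le: "\<forall>\<^sub>F n in sequentially. (\<integral>\<^sup>+x. f n x \<partial>M) \<le> ennreal (c n)"
    and c: "summable c" "\<And>n. 0 \<le> c n"
  shows "AE x in M. (\<lambda>n. f n x) \<longlonglongrightarrow> 0"
proof -
  obtain n0 where n0: "\<And>n. n \<ge> n0 \<Longrightarrow> (\<integral>\<^sup>+x. f n x \<partial>M) \<le> ennreal (c n)"
    using le by (auto simp: eventually_sequentially)
  have "(\<integral>\<^sup>+x. (\<Sum>n. f (n + n0) x) \<partial>M) = (\<Sum>n. \<integral>\<^sup>+x. f (n + n0) x \<partial>M)"
    using f by (rule nn_integral_suminf)
  also have "\<dots> \<le> (\<Sum>n. ennreal (c (n + n0)))"
    by (intro suminf_le n0) auto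
  also have "\<dots> < \<top>"
    using c summable_ignore_initial_segment[of c n0]
    by (subst suminf_ennreal2) auto
  finally have "AE x in M. (\<Sum>n. f (n + n0) x) \<noteq> \<infinity>"
    using f by (intro nn_integral_PInf_AE) auto
  then show ?thesis
    by eventually_elim
      (auto intro: LIMSEQ_offset[of _ n0] suminf_ennreal_finite_imp_LIMSEQ_0)
qed

text \<open>Finiteness of the factors excludes the product of \<open>0\<close> and infinity: its
  inverse is infinite, whereas the product of the two inverses is \<open>0\<close>.\<close>

lemma inverse_prod_ennreal:
  fixes f :: "'i \<Rightarrow> ennreal"
  assumes "\<And>i. i \<in> I \<Longrightarrow> f i \<noteq> \<top>"
  shows "inverse (\<Prod>i\<in>I. f i) = (\<Prod>i\<in>I. inverse (f i))"
  using assms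
proof (induction I rule: infinite_finite_induct)
  case (insert i I)
  then have "f i \<noteq> \<top>" "(\<Prod>i\<in>I. f i) \<noteq> \<top>"
    by (auto simp: ennreal_prod_eq_top)
  with insert show ?case
    by (simp add: ennreal_inverse_mult less_top)
qed auto


lemma ennreal_inverse_antimono: "a \<le> b \<Longrightarrow> inverse b \<le> inverse (a :: ennreal)"
  by (simp add: less_eq_ennreal.rep_eq inverse_ennreal.rep_eq ereal_inverse_antimono)

section \<open>Measurability and elementary bounds for the posterior\<close>

context dominated_model
begin

lemma sets_model_eq: "P \<in> space Prior \<Longrightarrow> sets P = sets \<mu>"
  by (subst model_density) auto

lemma sets_pow_measure_eq:
  "P \<in> space Prior \<Longrightarrow> sets (Pi\<^sub>M I (\<lambda>_. P)) = sets (Pi\<^sub>M I (\<lambda>_. \<mu>))"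
  by (intro sets_PiM_cong sets_model_eq) auto

lemma space_pow_measure_eq:
  "P \<in> space Prior \<Longrightarrow> space (Pi\<^sub>M I (\<lambda>_. P)) = space (Pi\<^sub>M I (\<lambda>_. \<mu>))"
  by (intro sets_eq_imp_space_eq sets_pow_measure_eq)

lemma borel_measurable_pow_measure_eq:
  "P \<in> space Prior \<Longrightarrow> borel_measurable (pow_measure P n) = borel_measurable (pow_measure \<mu> n)"
  by (intro measurable_cong_sets sets_pow_measure_eq) auto

lemma borel_measurable_density: "P \<in> space Prior \<Longrightarrow> p P \<in> borel_measurable \<mu>"
  using measurable_compose[OF measurable_Pair2' density_measurable] by simp

lemma likelihood_borel_measurable1:
  "P \<in> space Prior \<Longrightarrow> likelihood p n P \<in> borel_measurable (pow_measure \<mu> n)"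
  using measurable_compose[OF measurable_Pair2' likelihood_measurable[of n]] by simp

lemma likelihood_borel_measurable2:
  "x \<in> space (pow_measure \<mu> n) \<Longrightarrow> (\<lambda>P. likelihood p n P x) \<in> borel_measurable Prior"
  using measurable_compose[OF measurable_Pair1' likelihood_measurable[of n]] by simp

lemma predictive_ratio_measurable:
  "(\<lambda>(x, P). predictive_ratio Prior p n P x) \<in> borel_measurable (pow_measure \<mu> n \<Otimes>\<^sub>M Prior)"
proof -
  have "(\<lambda>x. \<integral>\<^sup>+P. likelihood p n P x \<partial>Prior) \<in> borel_measurable (pow_measure \<mu> n)"
    using likelihood_measurable[of n] by (rule prior.borel_measurable_nn_integral)
  from measurable_compose[OF measurable_fst this] show ?thesis
    using likelihood_measurable[of n]
    unfolding predictive_ratio_def case_prod_beta by measurable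
qed

lemma predictive_ratio_borel_measurable1:
  "P \<in> space Prior \<Longrightarrow> predictive_ratio Prior p n P \<in> borel_measurable (pow_measure \<mu> n)"
  using measurable_compose[OF measurable_Pair2' predictive_ratio_measurable[of n]] by simp

lemma predictive_ratio_borel_measurable2:
  "x \<in> space (pow_measure \<mu> n) \<Longrightarrow> (\<lambda>P. predictive_ratio Prior p n P x) \<in> borel_measurable Prior"
  using measurable_compose[OF measurable_Pair1' predictive_ratio_measurable[of n]] by simp

text \<open>The normalising integral is constant in \<open>P\<close>, so the division moves inside.
  This turns the posterior into an integral of one jointly measurable function, to which Fubini
  applies.\<close>

lemma posterior_eq_nn_integral_predictive_ratio:
  assumes "x \<in> space (pow_measure \<mu> n)" "A \<in> sets Prior"
  shows "posterior Prior p n A x = (\<integral>\<^sup>+P\<in>A. predictive_ratio Prior p n P x \<partial>Prior)"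
proof -
  have [measurable]: "(\<lambda>P. likelihood p n P x) \<in> borel_measurable Prior" "A \<in> sets Prior"
    using assms by (auto intro: likelihood_borel_measurable2)
  have "(\<integral>\<^sup>+P\<in>A. predictive_ratio Prior p n P x \<partial>Prior) =
      (\<integral>\<^sup>+P. likelihood p n P x * indicator A P / (\<integral>\<^sup>+Q. likelihood p n Q x \<partial>Prior) \<partial>Prior)"
    by (intro nn_integral_cong) (simp add: predictive_ratio_def ennreal_divide_times divide_ennreal_def mult_ac)
  then show ?thesis
    by (simp add: posterior_def nn_integral_divide)
qed

lemma posterior_measurable:
  assumes [measurable]: "A \<in> sets Prior"
  shows "posterior Prior p n A \<in> borel_measurable (pow_measure \<mu> n)"
proof -
  have "(\<lambda>(x, P). predictive_ratio Prior p n P x * indicator A P)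
      \<in> borel_measurable (pow_measure \<mu> n \<Otimes>\<^sub>M Prior)"
    using predictive_ratio_measurable[of n] unfolding case_prod_beta by measurable
  then have "(\<lambda>x. \<integral>\<^sup>+P\<in>A. predictive_ratio Prior p n P x \<partial>Prior) \<in> borel_measurable (pow_measure \<mu> n)"
    by (rule prior.borel_measurable_nn_integral)
  then show ?thesis
    by (rule measurable_cong[THEN iffD1, rotated])
      (simp add: posterior_eq_nn_integral_predictive_ratio assms)
qed

text \<open>Samples with vanishing or infinite prior predictive density are harmless: there the posterior
  is \<open>0\<close>, by the conventions \<open>0 / 0 = 0\<close> and \<open>a / \<infinity> = 0\<close> of \<^typ>\<open>ennreal\<close>.\<close>

lemma posterior_le_1: "posterior Prior p n A x \<le> 1"
proof -
  define m where "m = (\<integral>\<^sup>+P. likelihood p n P x \<partial>Prior)"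
  have "posterior Prior p n A x \<le> m / m"
    unfolding posterior_def m_def
    by (intro divide_right_mono_ennreal nn_integral_mono) (auto simp: indicator_def)
  also have "\<dots> \<le> 1"
    by (cases "m = 0 \<or> m = \<top>") (auto simp: less_top[symmetric])
  finally show ?thesis .
qed

lemma posterior_subadditive:
  assumes x: "x \<in> space (pow_measure \<mu> n)" and "finite I"
    and A: "A \<in> sets Prior" and W: "\<And>i. i \<in> I \<Longrightarrow> W i \<in> sets Prior" and sub: "A \<subseteq> (\<Union>i\<in>I. W i)"
  shows "posterior Prior p n A x \<le> (\<Sum>i\<in>I. posterior Prior p n (W i) x)"
proof -
  have "(indicator A P :: ennreal) \<le> (\<Sum>i\<in>I. indicator (W i) P)" for P
  proof (cases "P \<in> A")
    case True
    with sub obtain i where "i \<in> I" "P \<in> W i" by auto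
    then have "(1 :: ennreal) \<le> (\<Sum>i\<in>{i}. indicator (W i) P)" by simp
    also have "\<dots> \<le> (\<Sum>i\<in>I. indicator (W i) P)"
      using \<open>finite I\<close> \<open>i \<in> I\<close> by (intro sum_mono2) auto
    finally show ?thesis using True by simp
  qed simp
  then have "(\<integral>\<^sup>+P\<in>A. predictive_ratio Prior p n P x \<partial>Prior) \<le>
      (\<integral>\<^sup>+P. (\<Sum>i\<in>I. predictive_ratio Prior p n P x * indicator (W i) P) \<partial>Prior)"
    by (intro nn_integral_mono) (auto simp: sum_distrib_left[symmetric] intro: mult_left_mono)
  also have "\<dots> = (\<Sum>i\<in>I. \<integral>\<^sup>+P\<in>W i. predictive_ratio Prior p n P x \<partial>Prior)"
    using predictive_ratio_borel_measurable2[OF x] W by (intro nn_integral_sum) auto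
  finally show ?thesis
    using x A W by (simp add: posterior_eq_nn_integral_predictive_ratio)
qed

section \<open>Expected posterior mass: Fubini, tests and covers\<close>

lemma pair_sigma_finite_pow_measure:
  assumes "P0 \<in> space Prior"
  shows "pair_sigma_finite (pow_measure P0 n) Prior"
proof -
  interpret P0: prob_space P0 using assms by (rule model_prob_space)
  interpret prob_space "pow_measure P0 n" by (rule prob_space_PiM) (rule P0.prob_space_axioms)
  show ?thesis ..
qed

lemma measurable_pow_measure_pair_eq:
  "P0 \<in> space Prior \<Longrightarrow>
    borel_measurable (pow_measure P0 n \<Otimes>\<^sub>M Prior) = borel_measurable (pow_measure \<mu> n \<Otimes>\<^sub>M Prior)"
  by (intro measurable_cong_sets sets_pair_measure_cong sets_pow_measure_eq) auto

text \<open>The weight \<open>g\<close> serves two cases: \<open>1 - \<phi>\<close> for a test, and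
  the constant \<open>1\<close> for the plain expectation.\<close>

lemma nn_integral_posterior_times:
  assumes P0: "P0 \<in> space Prior" and A: "A \<in> sets Prior"
    and g: "g \<in> borel_measurable (pow_measure \<mu> n)"
  shows "(\<integral>\<^sup>+x. posterior Prior p n A x * g x \<partial>pow_measure P0 n) =
    (\<integral>\<^sup>+P\<in>A. (\<integral>\<^sup>+x. predictive_ratio Prior p n P x * g x \<partial>pow_measure P0 n) \<partial>Prior)"
proof -
  interpret PS: pair_sigma_finite "pow_measure P0 n" Prior
    using P0 by (rule pair_sigma_finite_pow_measure)
  let ?h = "\<lambda>(x, P). predictive_ratio Prior p n P x * g x * indicator A P"
  have h: "?h \<in> borel_measurable (pow_measure P0 n \<Otimes>\<^sub>M Prior)"
    using predictive_ratio_measurable[of n] A g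
    unfolding measurable_pow_measure_pair_eq[OF P0] case_prod_beta by measurable
  have "(\<integral>\<^sup>+x. posterior Prior p n A x * g x \<partial>pow_measure P0 n) =
      (\<integral>\<^sup>+x. (\<integral>\<^sup>+P. ?h (x, P) \<partial>Prior) \<partial>pow_measure P0 n)"
  proof (intro nn_integral_cong)
    fix x assume "x \<in> space (pow_measure P0 n)"
    then have x: "x \<in> space (pow_measure \<mu> n)" by (simp add: space_pow_measure_eq P0)
    have "posterior Prior p n A x * g x =
        (\<integral>\<^sup>+P. predictive_ratio Prior p n P x * indicator A P * g x \<partial>Prior)"
      using predictive_ratio_borel_measurable2[OF x] A x
      by (simp add: posterior_eq_nn_integral_predictive_ratio nn_integral_multc)
    then show "posterior Prior p n A x * g x = (\<integral>\<^sup>+P. ?h (x, P) \<partial>Prior)"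
      by (simp add: mult_ac)
  qed
  also have "\<dots> = (\<integral>\<^sup>+P. (\<integral>\<^sup>+x. ?h (x, P) \<partial>pow_measure P0 n) \<partial>Prior)"
    using h by (intro PS.Fubini'[symmetric]) (simp add: case_prod_beta)
  also have "\<dots> = (\<integral>\<^sup>+P\<in>A. (\<integral>\<^sup>+x. predictive_ratio Prior p n P x * g x \<partial>pow_measure P0 n) \<partial>Prior)"
    using predictive_ratio_borel_measurable1 g P0
    by (intro nn_integral_cong)
      (simp add: nn_integral_multc borel_measurable_pow_measure_eq)
  finally show ?thesis .
qed

text \<open>The posterior is split with weights \<open>\<phi>\<close> and \<open>1 - \<phi>\<close>.
  In the first part it is at most \<open>1\<close>, which leaves the error under \<open>P0\<close>;
  the second part goes through Fubini.\<close>

lemma nn_integral_posterior_test_le: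
  assumes P0: "P0 \<in> space Prior" and A: "A \<in> sets Prior" and test: "is_test \<mu> n \<phi>"
  shows "(\<integral>\<^sup>+x. posterior Prior p n A x \<partial>pow_measure P0 n) \<le>
    (\<integral>\<^sup>+x. ennreal (\<phi> x) \<partial>pow_measure P0 n) +
    (SUP P\<in>A. \<integral>\<^sup>+x. predictive_ratio Prior p n P x * ennreal (1 - \<phi> x) \<partial>pow_measure P0 n)"
    (is "_ \<le> _ + ?S")
proof -
  have [measurable]: "\<phi> \<in> borel_measurable (pow_measure \<mu> n)"
    and \<phi>: "\<And>x. x \<in> space (pow_measure \<mu> n) \<Longrightarrow> 0 \<le> \<phi> x \<and> \<phi> x \<le> 1"
    using test by (auto simp: is_test_def)
  have \<phi>_meas: "(\<lambda>x. ennreal (\<phi> x)) \<in> borel_measurable (pow_measure P0 n)"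
    "(\<lambda>x. posterior Prior p n A x * ennreal (1 - \<phi> x)) \<in> borel_measurable (pow_measure P0 n)"
    using posterior_measurable[OF A, of n] P0 by (simp_all add: borel_measurable_pow_measure_eq)
  have "(\<integral>\<^sup>+x. posterior Prior p n A x \<partial>pow_measure P0 n) \<le>
      (\<integral>\<^sup>+x. ennreal (\<phi> x) + posterior Prior p n A x * ennreal (1 - \<phi> x) \<partial>pow_measure P0 n)"
  proof (intro nn_integral_mono)
    fix x assume "x \<in> space (pow_measure P0 n)"
    then have *: "0 \<le> \<phi> x" "\<phi> x \<le> 1" using \<phi> P0 by (auto simp: space_pow_measure_eq)
    have "posterior Prior p n A x = posterior Prior p n A x * (ennreal (\<phi> x) + ennreal (1 - \<phi> x))"
      using * by (simp flip: ennreal_plus)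
    also have "\<dots> = posterior Prior p n A x * ennreal (\<phi> x) + posterior Prior p n A x * ennreal (1 - \<phi> x)"
      by (simp add: distrib_left)
    also have "\<dots> \<le> 1 * ennreal (\<phi> x) + posterior Prior p n A x * ennreal (1 - \<phi> x)"
      by (intro add_right_mono mult_right_mono posterior_le_1) auto
    finally show "posterior Prior p n A x \<le> ennreal (\<phi> x) + posterior Prior p n A x * ennreal (1 - \<phi> x)"
      by simp
  qed
  also have "\<dots> = (\<integral>\<^sup>+x. ennreal (\<phi> x) \<partial>pow_measure P0 n) +
      (\<integral>\<^sup>+P\<in>A. (\<integral>\<^sup>+x. predictive_ratio Prior p n P x * ennreal (1 - \<phi> x) \<partial>pow_measure P0 n) \<partial>Prior)"
    using \<phi>_meas A P0 by (simp add: nn_integral_add nn_integral_posterior_times)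
  \<comment> \<open>A prior integral over \<open>A\<close> is at most the supremum over
    \<open>A\<close>, because the total prior mass is \<open>1\<close>.\<close>
  also have "(\<integral>\<^sup>+P\<in>A. (\<integral>\<^sup>+x. predictive_ratio Prior p n P x * ennreal (1 - \<phi> x) \<partial>pow_measure P0 n) \<partial>Prior)
      \<le> (\<integral>\<^sup>+P. ?S \<partial>Prior)"
    by (intro nn_integral_mono) (auto simp: indicator_def intro: SUP_upper)
  also have "\<dots> = ?S" by (simp add: prior.emeasure_space_1)
  finally show ?thesis by simp
qed

lemma nn_integral_posterior_cover_le:
  assumes P0: "P0 \<in> space Prior" and A: "A \<in> sets Prior" and "finite I"
    and W: "\<And>i. i \<in> I \<Longrightarrow> W i \<in> sets Prior" and sub: "A \<subseteq> (\<Union>i\<in>I. W i)"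
    and test: "\<And>i. i \<in> I \<Longrightarrow> is_test \<mu> n (\<phi> i)"
    and le: "\<And>i. i \<in> I \<Longrightarrow> (\<integral>\<^sup>+x. ennreal (\<phi> i x) \<partial>pow_measure P0 n) +
      (SUP P\<in>W i. \<integral>\<^sup>+x. predictive_ratio Prior p n P x * ennreal (1 - \<phi> i x) \<partial>pow_measure P0 n) \<le> c"
  shows "(\<integral>\<^sup>+x. posterior Prior p n A x \<partial>pow_measure P0 n) \<le> of_nat (card I) * c"
proof -
  have "(\<integral>\<^sup>+x. posterior Prior p n A x \<partial>pow_measure P0 n) \<le>
      (\<integral>\<^sup>+x. (\<Sum>i\<in>I. posterior Prior p n (W i) x) \<partial>pow_measure P0 n)"
    using assms by (intro nn_integral_mono posterior_subadditive) (auto simp: space_pow_measure_eq)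
  also have "\<dots> = (\<Sum>i\<in>I. \<integral>\<^sup>+x. posterior Prior p n (W i) x \<partial>pow_measure P0 n)"
    using W P0 by (intro nn_integral_sum) (simp add: borel_measurable_pow_measure_eq posterior_measurable)
  also have "\<dots> \<le> (\<Sum>i\<in>I. c)"
    by (intro sum_mono order.trans[OF nn_integral_posterior_test_le le] P0 W test)
  finally show ?thesis by simp
qed

section \<open>Expected posterior mass through likelihood ratios against \<open>B\<close>\<close>

text \<open>The domain restriction costs nothing: \<open>p P0\<close> is positive
  \<open>P0\<close>-almost everywhere, and where \<open>p P\<close> vanishes the quotient is
  \<open>0\<close>, even over a zero denominator.\<close>

lemma ratio_expectation_eq:
  assumes P0: "P0 \<in> space Prior" and P: "P \<in> space Prior"
  shows "ratio_expectation p P0 P Q = (\<integral>\<^sup>+x. ennreal (p P x) / ennreal (p Q x) \<partial>P0)"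
proof -
  have "AE x in density \<mu> (\<lambda>x. ennreal (p P0 x)). p P0 x > 0"
    using borel_measurable_density[OF P0] by (subst AE_density) auto
  then have "AE x in P0. p P0 x > 0" by (subst model_density[OF P0])
  then show ?thesis
    unfolding ratio_expectation_def
    by (intro nn_integral_cong_AE, eventually_elim)
      (auto simp: indicator_def not_less ennreal_neg)
qed

text \<open>The quotient of likelihoods is a product of functions of single observations, and
  independence makes the integral the product of \<open>n\<close> equal factors.\<close>

lemma nn_integral_likelihood_ratio:
  assumes P0: "P0 \<in> space Prior" and P: "P \<in> space Prior" and Q: "Q \<in> space Prior"
  shows "(\<integral>\<^sup>+x. likelihood p n P x / likelihood p n Q x \<partial>pow_measure P0 n) =
    ratio_expectation p P0 P Q ^ n"
proof -
  interpret P0: prob_space P0 using P0 by (rule model_prob_space)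
  interpret PP: product_sigma_finite "\<lambda>_::nat. P0" by standard
  have [measurable]: "p P \<in> borel_measurable P0" "p Q \<in> borel_measurable P0"
    using borel_measurable_density P Q by (auto simp: measurable_cong_sets[OF sets_model_eq[OF P0] refl])
  have "(\<integral>\<^sup>+x. likelihood p n P x / likelihood p n Q x \<partial>pow_measure P0 n) =
      (\<integral>\<^sup>+x. (\<Prod>i<n. ennreal (p P (x i)) / ennreal (p Q (x i))) \<partial>pow_measure P0 n)"
    by (simp add: likelihood_def divide_ennreal_def inverse_prod_ennreal prod.distrib)
  also have "\<dots> = (\<Prod>i<n. \<integral>\<^sup>+x. ennreal (p P x) / ennreal (p Q x) \<partial>P0)"
    by (intro PP.product_nn_integral_prod) auto
  finally show ?thesis by (simp add: ratio_expectation_eq P0 P)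
qed

text \<open>The denominator is at least its integral over \<open>B\<close>, and Jensen's inequality
  bounds the reciprocal of that integral. The mass of \<open>B\<close> appears squared because the
  prior restricted to \<open>B\<close> is not normalised.\<close>

lemma predictive_ratio_le:
  assumes x: "x \<in> space (pow_measure \<mu> n)" and B: "B \<in> sets Prior"
    and pos: "emeasure Prior B > 0"
  shows "predictive_ratio Prior p n P x \<le>
    (\<integral>\<^sup>+Q\<in>B. likelihood p n P x / likelihood p n Q x \<partial>Prior) / (emeasure Prior B)\<^sup>2"
proof -
  \<comment> \<open>Jensen's inequality needs the restricted space: with an indicator inside
    \<open>f\<close> instead, the reciprocal would be infinite outside \<open>B\<close>.\<close>
  let ?R = "restrict_space Prior B"
  interpret R: finite_measure ?R
    using B by (intro finite_measure_restrict_space) auto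
  have [measurable]: "(\<lambda>Q. likelihood p n Q x) \<in> borel_measurable Prior" "B \<in> sets Prior"
    using x B by (auto intro: likelihood_borel_measurable2)
  have [simp]: "B \<inter> space Prior = B" using sets.sets_into_space[OF B] by auto
  define b where "b = emeasure Prior B"
  define m where "m = (\<integral>\<^sup>+Q\<in>B. likelihood p n Q x \<partial>Prior)"
  have b: "b \<noteq> 0" "b \<noteq> \<top>" using pos by (auto simp: b_def)
  have "b\<^sup>2 / m \<le> (\<integral>\<^sup>+Q\<in>B. inverse (likelihood p n Q x) \<partial>Prior)"
    using R.square_measure_over_nn_integral_le[of "\<lambda>Q. likelihood p n Q x"]
    by (simp add: b_def m_def nn_integral_restrict_space emeasure_restrict_space
        space_restrict_space measurable_restrict_space1)
  then have "b\<^sup>2 / m / b\<^sup>2 \<le> (\<integral>\<^sup>+Q\<in>B. inverse (likelihood p n Q x) \<partial>Prior) / b\<^sup>2"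
    by (rule divide_right_mono_ennreal)
  \<comment> \<open>Only \<open>b\<close> must be finite and nonzero for this cancellation;
    \<open>m\<close> may be \<open>0\<close> or infinite.\<close>
  also have "b\<^sup>2 / m / b\<^sup>2 = inverse m"
    using b mult_divide_eq_ennreal[of "b\<^sup>2" "inverse m"]
    by (simp add: divide_ennreal_def mult_ac power_eq_top_ennreal)
  finally have *: "inverse m \<le> (\<integral>\<^sup>+Q\<in>B. inverse (likelihood p n Q x) \<partial>Prior) / b\<^sup>2" .
  have "m \<le> (\<integral>\<^sup>+Q. likelihood p n Q x \<partial>Prior)"
    unfolding m_def by (intro nn_integral_mono) (auto simp: indicator_def)
  then have "predictive_ratio Prior p n P x \<le> likelihood p n P x * inverse m"
    unfolding predictive_ratio_def divide_ennreal_def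
    by (intro mult_left_mono ennreal_inverse_antimono) auto
  also have "\<dots> \<le> likelihood p n P x * ((\<integral>\<^sup>+Q\<in>B. inverse (likelihood p n Q x) \<partial>Prior) / b\<^sup>2)"
    by (intro mult_left_mono *) auto
  also have "\<dots> = (\<integral>\<^sup>+Q\<in>B. likelihood p n P x / likelihood p n Q x \<partial>Prior) / b\<^sup>2"
    by (simp add: ennreal_times_divide divide_ennreal_def mult.assoc nn_integral_cmult)
  finally show ?thesis by (simp add: b_def)
qed

text \<open>Integrating the pointwise bound and exchanging the integrals reduces the claim to
  likelihood ratios for fixed \<open>Q\<close>. The integral over \<open>B\<close> contributes a
  factor \<open>b\<close>, which cancels one of the two in the denominator.\<close>

lemma nn_integral_predictive_ratio_le:
  assumes P0: "P0 \<in> space Prior" and P: "P \<in> space Prior"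
    and B: "B \<in> sets Prior" and pos: "emeasure Prior B > 0"
    and le: "\<And>Q. Q \<in> B \<Longrightarrow> ratio_expectation p P0 P Q \<le> c"
  shows "(\<integral>\<^sup>+x. predictive_ratio Prior p n P x \<partial>pow_measure P0 n) \<le> c ^ n / emeasure Prior B"
proof -
  interpret PS: pair_sigma_finite "pow_measure P0 n" Prior
    using P0 by (rule pair_sigma_finite_pow_measure)
  define b where "b = emeasure Prior B"
  have b: "b \<noteq> 0" "b \<noteq> \<top>" using pos by (auto simp: b_def)
  let ?h = "\<lambda>(x, Q). likelihood p n P x / likelihood p n Q x * indicator B Q"
  have h: "?h \<in> borel_measurable (pow_measure P0 n \<Otimes>\<^sub>M Prior)"
    using likelihood_measurable[of n] measurable_compose[OF measurable_fst likelihood_borel_measurable1[OF P]] B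
    unfolding measurable_pow_measure_pair_eq[OF P0] case_prod_beta by measurable
  have "(\<integral>\<^sup>+x. predictive_ratio Prior p n P x \<partial>pow_measure P0 n) \<le>
      (\<integral>\<^sup>+x. (\<integral>\<^sup>+Q. ?h (x, Q) \<partial>Prior) / b\<^sup>2 \<partial>pow_measure P0 n)"
    using P0 B pos predictive_ratio_le[where P=P and n=n]
    by (intro nn_integral_mono) (simp add: b_def space_pow_measure_eq)
  also have "\<dots> = (\<integral>\<^sup>+x. (\<integral>\<^sup>+Q. ?h (x, Q) \<partial>Prior) \<partial>pow_measure P0 n) / b\<^sup>2"
    using h by (intro nn_integral_divide prior.borel_measurable_nn_integral) (simp add: case_prod_beta)
  also have "(\<integral>\<^sup>+x. (\<integral>\<^sup>+Q. ?h (x, Q) \<partial>Prior) \<partial>pow_measure P0 n) =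
      (\<integral>\<^sup>+Q. (\<integral>\<^sup>+x. ?h (x, Q) \<partial>pow_measure P0 n) \<partial>Prior)"
    using h by (intro PS.Fubini'[symmetric]) (simp add: case_prod_beta)
  also have "\<dots> = (\<integral>\<^sup>+Q\<in>B. ratio_expectation p P0 P Q ^ n \<partial>Prior)"
  proof (intro nn_integral_cong)
    fix Q assume Q: "Q \<in> space Prior"
    have "(\<lambda>x. likelihood p n P x / likelihood p n Q x) \<in> borel_measurable (pow_measure P0 n)"
      using likelihood_borel_measurable1 P Q P0 by (simp add: borel_measurable_pow_measure_eq)
    then show "(\<integral>\<^sup>+x. ?h (x, Q) \<partial>pow_measure P0 n) = ratio_expectation p P0 P Q ^ n * indicator B Q"
      using nn_integral_likelihood_ratio[OF P0 P Q, of n] by (simp add: nn_integral_multc)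
  qed
  also have "\<dots> \<le> (\<integral>\<^sup>+Q\<in>B. c ^ n \<partial>Prior)"
    using le by (intro nn_integral_mono) (auto simp: indicator_def intro: power_mono)
  also have "\<dots> = c ^ n * b" using B by (simp add: b_def nn_integral_cmult_indicator)
  also have "c ^ n * b / b\<^sup>2 = c ^ n / b"
    using b by (simp add: power2_eq_square divide_mult_eq)
  finally show ?thesis by (simp add: b_def divide_right_mono_ennreal)
qed

lemma nn_integral_posterior_le:
  assumes P0: "P0 \<in> space Prior" and A: "A \<in> sets Prior"
    and B: "B \<in> sets Prior" and pos: "emeasure Prior B > 0"
    and le: "\<And>P Q. P \<in> A \<Longrightarrow> Q \<in> B \<Longrightarrow> ratio_expectation p P0 P Q \<le> c"
  shows "(\<integral>\<^sup>+x. posterior Prior p n A x \<partial>pow_measure P0 n) \<le>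
    c ^ n / emeasure Prior B * emeasure Prior A"
proof -
  have "(\<integral>\<^sup>+x. posterior Prior p n A x \<partial>pow_measure P0 n) =
      (\<integral>\<^sup>+P\<in>A. (\<integral>\<^sup>+x. predictive_ratio Prior p n P x \<partial>pow_measure P0 n) \<partial>Prior)"
    using nn_integral_posterior_times[OF P0 A, of "\<lambda>_. 1" n] by simp
  also have "\<dots> \<le> (\<integral>\<^sup>+P\<in>A. c ^ n / emeasure Prior B \<partial>Prior)"
    using P0 B pos le
    by (intro nn_integral_mono)
      (auto simp: indicator_def intro!: nn_integral_predictive_ratio_le)
  finally show ?thesis using A by (simp add: nn_integral_cmult_indicator)
qed

section \<open>Passage to infinite samples\<close>

lemma posterior_cong:
  "(\<And>i. i < n \<Longrightarrow> x i = y i) \<Longrightarrow> posterior Prior p n A x = posterior Prior p n A y"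
  by (simp add: posterior_def likelihood_def)

lemma
  assumes P0: "P0 \<in> space Prior" and A: "A \<in> sets Prior"
  shows posterior_measurable_infinite_sample:
      "posterior Prior p n A \<in> borel_measurable (\<Pi>\<^sub>M i\<in>UNIV. P0)"
    and nn_integral_posterior_infinite_sample:
      "(\<integral>\<^sup>+X. posterior Prior p n A X \<partial>(\<Pi>\<^sub>M i\<in>UNIV. P0)) =
        (\<integral>\<^sup>+x. posterior Prior p n A x \<partial>pow_measure P0 n)"
proof -
  interpret P0: prob_space P0 using P0 by (rule model_prob_space)
  interpret product_prob_space "\<lambda>_::nat. P0" UNIV by standard
  have r: "(\<lambda>X. restrict X {..<n}) \<in> (\<Pi>\<^sub>M i\<in>UNIV. P0) \<rightarrow>\<^sub>M pow_measure P0 n"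
    by (rule measurable_restrict_subset) simp
  have m: "posterior Prior p n A \<in> borel_measurable (pow_measure P0 n)"
    using posterior_measurable[OF A] P0 by (simp add: borel_measurable_pow_measure_eq)
  have eq: "posterior Prior p n A X = posterior Prior p n A (restrict X {..<n})" for X
    by (rule posterior_cong) simp
  show "posterior Prior p n A \<in> borel_measurable (\<Pi>\<^sub>M i\<in>UNIV. P0)"
    using measurable_compose[OF r m] by (simp flip: eq)
  have "(\<integral>\<^sup>+x. posterior Prior p n A x \<partial>pow_measure P0 n) =
      (\<integral>\<^sup>+x. posterior Prior p n A x \<partial>distr (\<Pi>\<^sub>M i\<in>UNIV. P0) (pow_measure P0 n) (\<lambda>X. restrict X {..<n}))"
    \<comment> \<open>The first \<open>n\<close> coordinates of an infinite i.i.d. sample have law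
      \<open>pow_measure P0 n\<close>.\<close>
    by (subst distr_PiM_restrict_finite) auto
  also have "\<dots> = (\<integral>\<^sup>+X. posterior Prior p n A X \<partial>(\<Pi>\<^sub>M i\<in>UNIV. P0))"
    using r m by (simp add: nn_integral_distr flip: eq)
  finally show "(\<integral>\<^sup>+X. posterior Prior p n A X \<partial>(\<Pi>\<^sub>M i\<in>UNIV. P0)) =
        (\<integral>\<^sup>+x. posterior Prior p n A x \<partial>pow_measure P0 n)" ..
qed

lemma posterior_LIMSEQ_0_if_summable:
  assumes P0: "P0 \<in> space Prior" and A: "A \<in> sets Prior"
    and le: "\<forall>\<^sub>F n in sequentially. (\<integral>\<^sup>+x. posterior Prior p n A x \<partial>pow_measure P0 n) \<le> ennreal (c n)"
    and c: "summable c" "\<And>n. 0 \<le> c n"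
  shows "AE X in (\<Pi>\<^sub>M i\<in>UNIV. P0). (\<lambda>n. posterior Prior p n A X) \<longlonglongrightarrow> 0"
  using posterior_measurable_infinite_sample[OF P0 A] le c
  by (intro AE_LIMSEQ_0_if_summable_nn_integral[of _ _ c])
    (simp_all add: nn_integral_posterior_infinite_sample[OF P0 A])

end

section \<open>Exponential bounds and the conclusion\<close>

lemma summable_exp_neg_linear:
  fixes a :: real
  assumes "a > 0"
  shows "summable (\<lambda>n. exp (- (real n * a)))"
proof -
  have "summable (\<lambda>n. exp (- a) ^ n)" using assms by (intro summable_geometric) simp
  then show ?thesis by (simp add: exp_of_nat_mult[symmetric])
qed

theorem theorem4p1:
  fixes \<mu> :: "'a measure" and Prior :: "'a measure measure"
    and p :: "'a measure \<Rightarrow> 'a \<Rightarrow> real" and P0 :: "'a measure"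
    and V B :: "'a measure set" and Psub :: "nat \<Rightarrow> 'a measure set"
    and K L :: real
  assumes "dominated_model \<mu> Prior p"
    and "P0 \<in> space Prior"
    and "V \<in> sets Prior"
    and "\<And>n. n \<ge> 1 \<Longrightarrow> absolutely_continuous (prior_predictive \<mu> Prior n) (pow_measure P0 n)"
    and "K > 0" and "L > 0"
    and "\<And>n. Psub n \<in> sets Prior"
    and "\<forall>\<^sub>F n in sequentially.
      \<exists>(N::nat) W \<phi>. real N \<le> exp (1 / 2 * L * real n) \<and>
        (\<forall>i\<in>{1..N}. W i \<in> sets Prior) \<and> V \<inter> Psub n \<subseteq> (\<Union>i\<in>{1..N}. W i) \<and>
        (\<forall>i\<in>{1..N}. is_test \<mu> n (\<phi> i) \<and>
          (\<integral>\<^sup>+x. ennreal (\<phi> i x) \<partial>pow_measure P0 n) +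
          (SUP P\<in>W i. \<integral>\<^sup>+x. predictive_ratio Prior p n P x * ennreal (1 - \<phi> i x) \<partial>pow_measure P0 n)
            \<le> ennreal (exp (- (real n * L))))"
    and "B \<in> sets Prior" and "measure Prior B > 0"
    and "\<forall>\<^sub>F n in sequentially.
      measure Prior (space Prior - Psub n) \<le> exp (- (real n * K)) \<and>
      (SUP P\<in>V - Psub n. SUP Q\<in>B. ratio_expectation p P0 P Q) \<le> ennreal (exp (K / 2))"
  shows "AE X in (\<Pi>\<^sub>M i\<in>(UNIV::nat set). P0).
    (\<lambda>n. posterior Prior p n V X) \<longlonglongrightarrow> 0"
proof -
  interpret dominated_model \<mu> Prior p by fact
  note P0 = assms(2) and V = assms(3) and Psub = assms(7) and B = assms(9)
  define b where "b = measure Prior B"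
  have b: "b > 0" "emeasure Prior B = ennreal b"
    using assms(10) by (simp_all add: b_def prior.emeasure_eq_measure)
  \<comment> \<open>The first term is the cover size \<open>exp (nL/2)\<close> times the test bound
    \<open>exp (-nL)\<close>. The second is \<open>exp (nK/2) / b\<close> times the prior mass bound
    \<open>exp (-nK)\<close>.\<close>
  define c where "c n = exp (- (real n * (L / 2))) + exp (- (real n * (K / 2))) / b" for n
  have "\<forall>\<^sub>F n in sequentially.
      (\<integral>\<^sup>+x. posterior Prior p n V x \<partial>pow_measure P0 n) \<le> ennreal (c n)"
    using assms(8) assms(11)
  proof eventually_elim
    case (elim n)
    from elim(1) obtain N W \<phi> where N: "real N \<le> exp (1 / 2 * L * real n)"
      and W: "\<forall>i\<in>{1..N}. W i \<in> sets Prior" "V \<inter> Psub n \<subseteq> (\<Union>i\<in>{1..N}. W i)"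
      and \<phi>: "\<forall>i\<in>{1..N}. is_test \<mu> n (\<phi> i) \<and>
          (\<integral>\<^sup>+x. ennreal (\<phi> i x) \<partial>pow_measure P0 n) +
          (SUP P\<in>W i. \<integral>\<^sup>+x. predictive_ratio Prior p n P x * ennreal (1 - \<phi> i x) \<partial>pow_measure P0 n)
            \<le> ennreal (exp (- (real n * L)))"
      by blast
    have in_sets: "V \<inter> Psub n \<in> sets Prior" "V - Psub n \<in> sets Prior" using V Psub by auto
    have "(\<integral>\<^sup>+x. posterior Prior p n (V \<inter> Psub n) x \<partial>pow_measure P0 n) \<le>
        of_nat (card {1..N}) * ennreal (exp (- (real n * L)))"
      using W \<phi> in_sets P0 by (intro nn_integral_posterior_cover_le[where W=W and \<phi>=\<phi>]) auto
    also have "\<dots> = ennreal (real N * exp (- (real n * L)))"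
      by (simp add: ennreal_mult flip: ennreal_of_nat_eq_real_of_nat)
    also have "\<dots> \<le> ennreal (exp (1 / 2 * L * real n) * exp (- (real n * L)))"
      using N by (intro ennreal_leI mult_right_mono) auto
    also have "exp (1 / 2 * L * real n) * exp (- (real n * L)) = exp (- (real n * (L / 2)))"
      by (simp add: mult_exp_exp algebra_simps)
    finally have 1: "(\<integral>\<^sup>+x. posterior Prior p n (V \<inter> Psub n) x \<partial>pow_measure P0 n) \<le>
        ennreal (exp (- (real n * (L / 2))))" .
    have "ratio_expectation p P0 P Q \<le> ennreal (exp (K / 2))" if "P \<in> V - Psub n" "Q \<in> B" for P Q
      using elim(2) that by (auto simp: SUP_le_iff)
    then have "(\<integral>\<^sup>+x. posterior Prior p n (V - Psub n) x \<partial>pow_measure P0 n) \<le>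
        ennreal (exp (K / 2)) ^ n / emeasure Prior B * emeasure Prior (V - Psub n)"
      using P0 in_sets B b by (intro nn_integral_posterior_le) auto
    also have "emeasure Prior (V - Psub n) \<le> emeasure Prior (space Prior - Psub n)"
      using V Psub sets.sets_into_space[OF V] by (intro emeasure_mono) auto
    also have "\<dots> \<le> ennreal (exp (- (real n * K)))"
      using elim(2) by (simp add: prior.emeasure_eq_measure ennreal_leI)
    also have "ennreal (exp (K / 2)) ^ n / emeasure Prior B * ennreal (exp (- (real n * K))) =
        ennreal (exp (K / 2) ^ n / b * exp (- (real n * K)))"
      using b by (simp add: ennreal_power divide_ennreal flip: ennreal_mult)
    also have "exp (K / 2) ^ n / b * exp (- (real n * K)) = exp (- (real n * (K / 2))) / b"
      by (simp add: exp_of_nat_mult[symmetric] mult_exp_exp algebra_simps)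
    finally have 2: "(\<integral>\<^sup>+x. posterior Prior p n (V - Psub n) x \<partial>pow_measure P0 n) \<le>
        ennreal (exp (- (real n * (K / 2))) / b)"
      by (simp add: mult_left_mono)
    have "(\<integral>\<^sup>+x. posterior Prior p n V x \<partial>pow_measure P0 n) \<le>
        (\<integral>\<^sup>+x. posterior Prior p n (V \<inter> Psub n) x + posterior Prior p n (V - Psub n) x
          \<partial>pow_measure P0 n)"
    proof (intro nn_integral_mono)
      fix x assume "x \<in> space (pow_measure P0 n)"
      then have "posterior Prior p n V x \<le>
          (\<Sum>A\<in>{V \<inter> Psub n, V - Psub n}. posterior Prior p n A x)"
        using in_sets V P0
        by (intro posterior_subadditive[where W="\<lambda>A. A"]) (auto simp: space_pow_measure_eq)
      also have "\<dots> \<le> posterior Prior p n (V \<inter> Psub n) x + posterior Prior p n (V - Psub n) x"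
        \<comment> \<open>The sum runs over a set of sets, so it collapses to a single term if the
          two pieces coincide, which happens when both are empty. Hence an inequality and not an
          equation.\<close>
        by (cases "V \<inter> Psub n = V - Psub n") auto
      finally show "posterior Prior p n V x \<le>
          posterior Prior p n (V \<inter> Psub n) x + posterior Prior p n (V - Psub n) x" .
    qed
    also have "\<dots> = (\<integral>\<^sup>+x. posterior Prior p n (V \<inter> Psub n) x \<partial>pow_measure P0 n) +
        (\<integral>\<^sup>+x. posterior Prior p n (V - Psub n) x \<partial>pow_measure P0 n)"
      using in_sets P0
      by (intro nn_integral_add) (auto simp: borel_measurable_pow_measure_eq posterior_measurable)
    also have "\<dots> \<le> ennreal (c n)"
      using add_mono[OF 1 2] b by (simp add: c_def ennreal_plus)
    finally show ?case .
  qed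
  moreover have "summable c"
    using assms(5,6) unfolding c_def
    by (intro summable_add summable_divide summable_exp_neg_linear) auto
  moreover have "0 \<le> c n" for n using b by (simp add: c_def)
  ultimately show ?thesis by (intro posterior_LIMSEQ_0_if_summable P0 V)
qed

end
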